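(* Let $C\in\mathcal{C}$ be a bivariate copula. For $G_1,G_2\in\mathcal{G}$ the following implication holds: $$G_1\preceq_{st}G_2\ \Rightarrow\ \eta(C)\leq\eta(C,G_1,G_2).$$
   Context: $\mathcal{C}$ is the class of all bivariate copulas (joint distribution functions on $[0,1]^2$ with uniform marginals). $\mathcal{G}$ is the class of all probability distribution functions on $\mathbb{R}$ that are continuous and strictly increasing in the domain where they are positive and smaller than one. For $G_1,G_2\in\mathcal{G}$ and $C\in\mathcal{C}$, $\eta(C,G_1,G_2):=\mathbb{P}(X_1\leq X_2)$, where $(X_1,X_2)$ is a random vector with joint distribution function $F(x_1,x_2)=C(G_1(x_1),G_2(x_2))$. For $G\in\mathcal{G}$ the value $\eta(C,G,G)$ does not depend on $G$; it is denoted $\eta(C):=\eta(C,G,G)$, and it equals $\int_{A\cap[0,1]^2}dC$ with $A=\{(x_1,x_2)\in\mathbb{R}^2: x_1\leq x_2\}$. The usual stochastic order is: $G_1\preceq_{st}G_2$ iff $G_1(t)\geq G_2(t)$ for all $t\in\mathbb{R}$. *)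

theory Defs
  imports "HOL-Probability.Probability"
begin

definition joint_cdf :: "(real \<times> real) measure \<Rightarrow> real \<Rightarrow> real \<Rightarrow> real" where
  "joint_cdf M x y = measure M ({..x} \<times> {..y})"

text \<open>Only the values of \<open>C\<close> on the unit square matter; a copula is represented by any
  extension to the whole plane.\<close>

definition copulas :: "(real \<Rightarrow> real \<Rightarrow> real) set" where
  "copulas = {C. \<exists>M. prob_space M \<and> sets M = sets borel \<and>
     distr M borel fst = uniform_measure lborel {0..1} \<and>
     distr M borel snd = uniform_measure lborel {0..1} \<and>
     (\<forall>u\<in>{0..1}. \<forall>v\<in>{0..1}. C u v = joint_cdf M u v)}"

text \<open>Continuity is required on the whole line, so no atoms are allowed at the end points
  of the support; strict monotonicity only where the value lies strictly between 0 and 1.\<close>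

definition \<G> :: "(real \<Rightarrow> real) set" where
  "\<G> = {G. (\<exists>M. real_distribution M \<and> G = cdf M) \<and> continuous_on UNIV G \<and>
     strict_mono_on {x. 0 < G x \<and> G x < 1} G}"

definition joint_law ::
  "(real \<Rightarrow> real \<Rightarrow> real) \<Rightarrow> (real \<Rightarrow> real) \<Rightarrow> (real \<Rightarrow> real) \<Rightarrow> (real \<times> real) measure" where
  "joint_law C G1 G2 = (THE M. prob_space M \<and> sets M = sets borel \<and>
     (\<forall>x1 x2. joint_cdf M x1 x2 = C (G1 x1) (G2 x2)))"

definition \<eta> :: "(real \<Rightarrow> real \<Rightarrow> real) \<Rightarrow> (real \<Rightarrow> real) \<Rightarrow> (real \<Rightarrow> real) \<Rightarrow> real" where
  "\<eta> C G1 G2 = measure (joint_law C G1 G2) {(x1, x2). x1 \<le> x2}"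

definition \<eta>\<^sub>0 :: "(real \<Rightarrow> real \<Rightarrow> real) \<Rightarrow> real" where
  "\<eta>\<^sub>0 C = (THE e. \<forall>G\<in>\<G>. \<eta> C G G = e)"

definition st_le :: "(real \<Rightarrow> real) \<Rightarrow> (real \<Rightarrow> real) \<Rightarrow> bool" (infix "\<preceq>\<^sub>s\<^sub>t" 50) where
  "G1 \<preceq>\<^sub>s\<^sub>t G2 \<longleftrightarrow> (\<forall>t. G1 t \<ge> G2 t)"

text \<open>The remaining facts show that the two definite descriptions above are meaningful.\<close>

lemma joint_cdf_unique:
  assumes M: "prob_space M" "sets M = sets borel" and N: "prob_space N" "sets N = sets borel"
    and eq: "\<And>x y. joint_cdf M x y = joint_cdf N x y"
  shows "M = N"
proof -
  interpret M: prob_space M by fact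
  interpret N: prob_space N by fact
  let ?E = "range (\<lambda>a :: real \<times> real. {..a})"
  have atMost: "{..a} = {..fst a} \<times> {..snd a}" for a :: "real \<times> real"
    by (auto simp: less_eq_prod_def)
  have borel: "sets borel = sigma_sets UNIV ?E"
    by (subst borel_eq_atMost) simp
  show ?thesis
  proof (rule measure_eqI_generator_eq[where E = ?E and \<Omega> = UNIV and
        A = "\<lambda>n. {..(real n, real n)}"])
    show "Int_stable ?E"
    proof -
      have "{..a} \<inter> {..b} = {..inf a b}" for a b :: "real \<times> real"
        by auto
      then show ?thesis
        unfolding Int_stable_def by blast
    qed
    show "emeasure M X = emeasure N X" if "X \<in> ?E" for X
      using that eq
      by (auto simp: atMost joint_cdf_def M.emeasure_eq_measure N.emeasure_eq_measure)
    show "(\<Union>n. {..(real n, real n)}) = UNIV"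
    proof (intro equalityI subset_UNIV subsetI)
      fix z :: "real \<times> real"
      obtain n where "max (fst z) (snd z) \<le> real n"
        using real_arch_simple by blast
      then show "z \<in> (\<Union>n. {..(real n, real n)})"
        by (auto simp: less_eq_prod_def)
    qed
  qed (auto simp: M N borel)
qed

lemma joint_law_eqI:
  assumes "prob_space M" "sets M = sets borel"
    and "\<And>x y. joint_cdf M x y = C (G1 x) (G2 y)"
  shows "joint_law C G1 G2 = M"
  unfolding joint_law_def
  using assms by (intro the_equality) (auto intro!: joint_cdf_unique)

lemma \<eta>_eq_prob:
  assumes "prob_space \<Omega>" and [measurable]: "X1 \<in> borel_measurable \<Omega>" "X2 \<in> borel_measurable \<Omega>"
    and F: "\<And>x1 x2. measure \<Omega> {\<omega>\<in>space \<Omega>. X1 \<omega> \<le> x1 \<and> X2 \<omega> \<le> x2} = C (G1 x1) (G2 x2)"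
  shows "\<eta> C G1 G2 = measure \<Omega> {\<omega>\<in>space \<Omega>. X1 \<omega> \<le> X2 \<omega>}"
proof -
  interpret prob_space \<Omega> by fact
  let ?X = "\<lambda>\<omega>. (X1 \<omega>, X2 \<omega>)"
  have "joint_law C G1 G2 = distr \<Omega> borel ?X"
  proof (rule joint_law_eqI)
    show "joint_cdf (distr \<Omega> borel ?X) x y = C (G1 x) (G2 y)" for x y
      unfolding joint_cdf_def F[symmetric]
      by (subst measure_distr) (auto intro!: arg_cong[where f = "measure \<Omega>"] borel_closed closed_Times)
  qed (auto intro!: prob_space_distr)
  moreover have "{(x1, x2). x1 \<le> x2} \<in> sets (borel :: (real \<times> real) measure)"
  proof -
    have "closed {z :: real \<times> real. fst z \<le> snd z}"
      by (intro closed_Collect_le continuous_intros)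
    then show ?thesis
      by (auto simp: case_prod_beta' intro: borel_closed)
  qed
  ultimately show ?thesis
    unfolding \<eta>_def
    by (simp add: measure_distr) (auto intro!: arg_cong[where f = "measure \<Omega>"])
qed

definition quantile :: "(real \<Rightarrow> real) \<Rightarrow> real \<Rightarrow> real" where
  "quantile G \<omega> = (if \<omega> \<in> {0<..<1} then Inf {x. \<omega> \<le> G x} else 0)"

lemma quantile:
  assumes "G \<in> \<G>"
  shows quantile_measurable: "quantile G \<in> borel_measurable borel"
    and quantile_le_iff: "0 < \<omega> \<Longrightarrow> \<omega> < 1 \<Longrightarrow> quantile G \<omega> \<le> x \<longleftrightarrow> \<omega> \<le> G x"
    and cdf_range: "G x \<in> {0..1}"
    and cdf_quantile: "0 < \<omega> \<Longrightarrow> \<omega> < 1 \<Longrightarrow> G (quantile G \<omega>) = \<omega>"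
proof -
  obtain M where M: "real_distribution M" and G: "G = cdf M" and G_cont: "continuous_on UNIV G"
    using assms by (auto simp: \<G>_def)
  interpret real_distribution M by fact
  interpret cdf_distribution M by standard
  show "quantile G \<in> borel_measurable borel"
  proof -
    have "{\<omega>. \<omega> \<in> {0<..<1}} = {0<..<1::real}"
      by auto
    then show ?thesis
      unfolding quantile_def G
      using measurable_CI by (subst measurable_If_restrict_space_iff) simp_all
  qed
  show le: "quantile G \<omega> \<le> x \<longleftrightarrow> \<omega> \<le> G x" if "0 < \<omega>" "\<omega> < 1" for \<omega> x
    using pseudoinverse[of \<omega> x] that by (simp add: quantile_def G)
  show "G x \<in> {0..1}"
    by (simp add: G cdf_nonneg cdf_bounded_prob)
  assume \<omega>: "0 < \<omega>" "\<omega> < 1"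
  let ?q = "quantile G \<omega>"
  have "G y \<le> \<omega>" if "y < ?q" for y
    using le[OF \<omega>, of y] that by auto
  then have "\<forall>\<^sub>F y in at_left ?q. G y \<le> \<omega>"
    by (auto simp: eventually_at_filter)
  moreover have "(G \<longlongrightarrow> G ?q) (at_left ?q)"
    using G_cont by (simp add: continuous_on_eq_continuous_at isCont_def filterlim_at_split)
  ultimately have "G ?q \<le> \<omega>"
    by (intro tendsto_upperbound) auto
  then show "G ?q = \<omega>"
    using le[OF \<omega>, of ?q] by simp
qed

lemma AE_unit_interval:
  assumes "prob_space M" "sets M = sets borel" "f \<in> borel_measurable borel"
    "distr M borel f = uniform_measure lborel {0..1}"
  shows "AE z in M. 0 < f z \<and> f z < (1::real)"
proof -
  have "AE x in distr M borel f. 0 < x \<and> x < (1::real)"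
    unfolding assms(4)
    using AE_lborel_singleton[of "0::real"] AE_lborel_singleton[of "1::real"]
    by (intro AE_uniform_measureI) auto
  then show ?thesis
    using assms by (subst (asm) AE_distr_iff) (auto simp: measurable_def cong: measurable_cong_sets)
qed

lemma copula_representation:
  assumes "C \<in> copulas"
  shows "\<exists>M. prob_space M \<and> sets M = sets borel \<and>
    (AE z in M. 0 < fst z \<and> fst z < 1) \<and> (AE z in M. 0 < snd z \<and> snd z < 1) \<and>
    (\<forall>u\<in>{0..1}. \<forall>v\<in>{0..1}. C u v = joint_cdf M u v)"
proof -
  obtain M where M: "prob_space M" "sets M = sets borel"
    "distr M borel fst = uniform_measure lborel {0..1}"
    "distr M borel snd = uniform_measure lborel {0..1}"
    "\<And>u v. u \<in> {0..1} \<Longrightarrow> v \<in> {0..1} \<Longrightarrow> C u v = joint_cdf M u v"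
    using assms by (auto simp: copulas_def)
  show ?thesis
    using M(1,2,5) AE_unit_interval[OF M(1,2) _ M(3)] AE_unit_interval[OF M(1,2) _ M(4)]
    by (intro exI[of _ M]) (auto simp: borel_prod[symmetric])
qed

lemma quantile_transform:
  assumes G: "G1 \<in> \<G>" "G2 \<in> \<G>"
    and M: "prob_space M" "sets M = sets borel"
      "AE z in M. 0 < fst z \<and> fst z < 1" "AE z in M. 0 < snd z \<and> snd z < 1"
      "\<And>u v. u \<in> {0..1} \<Longrightarrow> v \<in> {0..1} \<Longrightarrow> C u v = joint_cdf M u v"
  shows quantile_transform_joint_cdf:
      "joint_cdf (distr M borel (\<lambda>z. (quantile G1 (fst z), quantile G2 (snd z)))) x1 x2 =
       C (G1 x1) (G2 x2)" (is "joint_cdf ?N x1 x2 = _")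
    and \<eta>_quantile:
      "\<eta> C G1 G2 = measure M {z. quantile G1 (fst z) \<le> quantile G2 (snd z)}"
proof -
  interpret prob_space M by fact
  note [measurable_cong] = M(2)
  note [measurable] = quantile_measurable[OF G(1)] quantile_measurable[OF G(2)]
  have space: "space M = UNIV"
    using sets_eq_imp_space_eq[OF M(2)] by simp
  have fst_snd [measurable]: "fst \<in> borel_measurable M" "snd \<in> borel_measurable M"
    by (simp_all add: measurable_cong_sets[OF M(2) refl] borel_prod[symmetric])
  have F: "measure M {z \<in> space M. quantile G1 (fst z) \<le> x1 \<and> quantile G2 (snd z) \<le> x2} =
      C (G1 x1) (G2 x2)" for x1 x2
  proof -
    have "measure M {z \<in> space M. quantile G1 (fst z) \<le> x1 \<and> quantile G2 (snd z) \<le> x2} =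
        measure M {z \<in> space M. fst z \<le> G1 x1 \<and> snd z \<le> G2 x2}"
    proof (intro measure_eq_AE)
      show "AE z in M. z \<in> {z \<in> space M. quantile G1 (fst z) \<le> x1 \<and> quantile G2 (snd z) \<le> x2} \<longleftrightarrow>
          z \<in> {z \<in> space M. fst z \<le> G1 x1 \<and> snd z \<le> G2 x2}"
        using M(3,4) by eventually_elim (auto simp: quantile_le_iff G)
    qed measurable
    also have "{z \<in> space M. fst z \<le> G1 x1 \<and> snd z \<le> G2 x2} = {..G1 x1} \<times> {..G2 x2}"
      by (auto simp: space)
    finally show ?thesis
      using M(5)[OF cdf_range[OF G(1)] cdf_range[OF G(2)]] by (simp add: joint_cdf_def)
  qed
  show "joint_cdf ?N x1 x2 = C (G1 x1) (G2 x2)"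
    unfolding joint_cdf_def F[symmetric]
    by (subst measure_distr)
       (auto intro!: arg_cong[where f = "measure M"] borel_closed closed_Times)
  have "\<eta> C G1 G2 = measure M {z \<in> space M. quantile G1 (fst z) \<le> quantile G2 (snd z)}"
    using F by (intro \<eta>_eq_prob[OF M(1)]) measurable
  then show "\<eta> C G1 G2 = measure M {z. quantile G1 (fst z) \<le> quantile G2 (snd z)}"
    by (simp add: space)
qed

lemma joint_law:
  assumes "C \<in> copulas" "G1 \<in> \<G>" "G2 \<in> \<G>"
  shows "prob_space (joint_law C G1 G2)" "sets (joint_law C G1 G2) = sets borel"
    "joint_cdf (joint_law C G1 G2) x1 x2 = C (G1 x1) (G2 x2)"
proof -
  obtain M where M: "prob_space M" "sets M = sets borel"
    "AE z in M. 0 < fst z \<and> fst z < 1" "AE z in M. 0 < snd z \<and> snd z < 1"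
    "\<And>u v. u \<in> {0..1} \<Longrightarrow> v \<in> {0..1} \<Longrightarrow> C u v = joint_cdf M u v"
    using copula_representation[OF assms(1)] by fast
  interpret prob_space M by fact
  let ?N = "distr M borel (\<lambda>z. (quantile G1 (fst z), quantile G2 (snd z)))"
  note [measurable_cong] = M(2)
  note [measurable] = quantile_measurable[OF assms(2)] quantile_measurable[OF assms(3)]
  have [measurable]: "fst \<in> borel_measurable M" "snd \<in> borel_measurable M"
    by (simp_all add: measurable_cong_sets[OF M(2) refl] borel_prod[symmetric])
  have N: "prob_space ?N" "sets ?N = sets borel"
    by (auto intro!: prob_space_distr)
  have "joint_law C G1 G2 = ?N"
    by (intro joint_law_eqI N quantile_transform_joint_cdf[OF assms(2,3) M])
  then show "prob_space (joint_law C G1 G2)" "sets (joint_law C G1 G2) = sets borel"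
    "joint_cdf (joint_law C G1 G2) x1 x2 = C (G1 x1) (G2 x2)"
    using N quantile_transform_joint_cdf[OF assms(2,3) M] by simp_all
qed

lemma cdf_uniform_mem_\<G>: "cdf (uniform_measure lborel {0..1}) \<in> \<G>"
proof -
  let ?U = "uniform_measure lborel {0..1::real}"
  have cdf: "cdf ?U x = max 0 (min 1 x)" for x
  proof -
    have "{0..1} \<inter> {..x} = {0..min 1 x}"
      by auto
    then show ?thesis
      by (simp add: cdf_def2 measure_uniform_measure measure_def[of lborel] max_def)
  qed
  have "real_distribution ?U"
    by (auto simp: real_distribution_def real_distribution_axioms_def
        intro!: prob_space_uniform_measure)
  moreover have "continuous_on UNIV (cdf ?U)"
    unfolding cdf by (intro continuous_intros)
  moreover have "strict_mono_on {x. 0 < cdf ?U x \<and> cdf ?U x < 1} (cdf ?U)"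
    by (auto simp: strict_mono_on_def cdf)
  ultimately show ?thesis
    by (auto simp: \<G>_def)
qed

lemma \<eta>_diag:
  assumes C: "C \<in> copulas" and G: "G \<in> \<G>"
  shows "\<eta> C G G = \<eta>\<^sub>0 C"
proof -
  obtain M where M: "prob_space M" "sets M = sets borel"
    "AE z in M. 0 < fst z \<and> fst z < 1" "AE z in M. 0 < snd z \<and> snd z < 1"
    "\<And>u v. u \<in> {0..1} \<Longrightarrow> v \<in> {0..1} \<Longrightarrow> C u v = joint_cdf M u v"
    using copula_representation[OF C] by fast
  interpret prob_space M by fact
  note [measurable_cong] = M(2)
  have [measurable]: "fst \<in> borel_measurable M" "snd \<in> borel_measurable M"
    by (simp_all add: measurable_cong_sets[OF M(2) refl] borel_prod[symmetric])
  have space: "space M = UNIV"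
    using sets_eq_imp_space_eq[OF M(2)] by simp
  have diag: "\<eta> C H H = measure M {z \<in> space M. fst z \<le> snd z}" if H: "H \<in> \<G>" for H
  proof -
    note [measurable] = quantile_measurable[OF H]
    have "\<eta> C H H = measure M {z \<in> space M. quantile H (fst z) \<le> quantile H (snd z)}"
      using \<eta>_quantile[OF H H M(1-4), of C] M(5) by (simp add: space)
    also have "\<dots> = measure M {z \<in> space M. fst z \<le> snd z}"
    proof (intro measure_eq_AE)
      show "AE z in M. z \<in> {z \<in> space M. quantile H (fst z) \<le> quantile H (snd z)} \<longleftrightarrow>
          z \<in> {z \<in> space M. fst z \<le> snd z}"
        using M(3,4) by eventually_elim (auto simp: quantile_le_iff[OF H] cdf_quantile[OF H])
    qed measurable
    finally show ?thesis .
  qed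
  have "\<eta>\<^sub>0 C = measure M {z \<in> space M. fst z \<le> snd z}"
    unfolding \<eta>\<^sub>0_def using diag cdf_uniform_mem_\<G> by (intro the_equality) auto
  then show ?thesis
    using diag[OF G] by simp
qed

end

theory Submission
  imports Defs
begin

text \<open>
  The idea is a quantile coupling. Let \<open>(U, V)\<close> be distributed according to the copula \<open>C\<close>, and
  write \<open>q\<^sub>1\<close>, \<open>q\<^sub>2\<close> for the quantile functions of \<open>G1\<close>, \<open>G2\<close>. By \<open>\<eta>_quantile\<close>, \<open>\<eta> C G1 G2\<close> is
  the probability of \<open>q\<^sub>1 U \<le> q\<^sub>2 V\<close>, and by \<open>\<eta>_diag\<close>, \<open>\<eta>\<^sub>0 C\<close> may be computed with \<open>G1\<close> in both
  coordinates, that is, as the probability of \<open>q\<^sub>1 U \<le> q\<^sub>1 V\<close>. Both events live on the same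
  probability space, and the stochastic order gives \<open>q\<^sub>1 \<le> q\<^sub>2\<close>, so that almost surely the second
  event implies the first.
\<close>

text \<open>The larger function \<open>G1\<close> reaches the level \<open>\<omega>\<close> no later than \<open>G2\<close> does.\<close>

lemma quantile_mono_st:
  assumes "G1 \<in> \<G>" "G2 \<in> \<G>" "G1 \<preceq>\<^sub>s\<^sub>t G2" "0 < \<omega>" "\<omega> < 1"
  shows "quantile G1 \<omega> \<le> quantile G2 \<omega>"
proof -
  have "\<omega> \<le> G2 (quantile G2 \<omega>)"
    using assms by (simp add: cdf_quantile)
  also have "\<dots> \<le> G1 (quantile G2 \<omega>)"
    using assms by (simp add: st_le_def)
  finally show ?thesis
    using assms by (simp add: quantile_le_iff)
qed

theorem proposition4:
  fixes C :: "real \<Rightarrow> real \<Rightarrow> real" and G1 G2 :: "real \<Rightarrow> real"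
  assumes "C \<in> copulas" and "G1 \<in> \<G>" and "G2 \<in> \<G>"
  shows "G1 \<preceq>\<^sub>s\<^sub>t G2 \<longrightarrow> \<eta>\<^sub>0 C \<le> \<eta> C G1 G2"
proof
  assume st: "G1 \<preceq>\<^sub>s\<^sub>t G2"
  obtain M where M: "prob_space M" "sets M = sets borel"
    "AE z in M. 0 < fst z \<and> fst z < 1" "AE z in M. 0 < snd z \<and> snd z < 1"
    "\<And>u v. u \<in> {0..1} \<Longrightarrow> v \<in> {0..1} \<Longrightarrow> C u v = joint_cdf M u v"
    using copula_representation[OF assms(1)] by fast
  interpret prob_space M by fact
  note [measurable_cong] = M(2)
  note [measurable] = quantile_measurable[OF assms(2)] quantile_measurable[OF assms(3)]
  have [measurable]: "fst \<in> borel_measurable M" "snd \<in> borel_measurable M"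
    by (simp_all add: measurable_cong_sets[OF M(2) refl] borel_prod[symmetric])
  have space: "space M = UNIV"
    using sets_eq_imp_space_eq[OF M(2)] by simp
  have "\<eta>\<^sub>0 C = \<eta> C G1 G1"
    using \<eta>_diag[OF assms(1,2)] by simp
  also have "\<dots> = measure M {z \<in> space M. quantile G1 (fst z) \<le> quantile G1 (snd z)}"
    using \<eta>_quantile[OF assms(2,2) M(1-4), of C] M(5) by (simp add: space)
  also have "\<dots> \<le> measure M {z \<in> space M. quantile G1 (fst z) \<le> quantile G2 (snd z)}"
  proof (rule finite_measure_mono_AE)
    show "AE z in M. z \<in> {z \<in> space M. quantile G1 (fst z) \<le> quantile G1 (snd z)} \<longrightarrow>
        z \<in> {z \<in> space M. quantile G1 (fst z) \<le> quantile G2 (snd z)}"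
      using M(4)
      by eventually_elim (auto intro: order_trans quantile_mono_st[OF assms(2,3) st])
  qed measurable
  also have "\<dots> = \<eta> C G1 G2"
    using \<eta>_quantile[OF assms(2,3) M(1-4), of C] M(5) by (simp add: space)
  finally show "\<eta>\<^sub>0 C \<le> \<eta> C G1 G2" .
qed

end
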